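(* The following conditions are equivalent for a locale $L$: (i) $L$ is hereditarily IED; (ii) $((\bigvee a_i)\to b)\to b\le\bigvee((a_i\to b)\to b)$ for all $b\in L$ and all $\{a_i\}_{i\in I}\subseteq L$; (iii) $((\bigvee a_i)\to b)\to b\le\bigvee((a_i\to b)\to b)$ for all $b\in L$ and all $\{a_i\}_{i\in I}\subseteq\mathfrak{c}(b)$.
   Context: A locale (= frame) is a complete lattice $L$ with $a\wedge\bigvee B=\bigvee\{a\wedge b\mid b\in B\}$ for all $a\in L$, $B\subseteq L$. It is a complete Heyting algebra with Heyting operation $\to$; the pseudocomplement of $a$ is $a^*=a\to 0$, and $a^{**}=(a^* )^*$. Joins without displayed index are taken over $i\in I$. A sublocale of $L$ is a subset $S\subseteq L$ closed under arbitrary meets in $L$ and such that $a\to s\in S$ for all $a\in L$, $s\in S$; with the induced order $S$ is itself a locale. For $b\in L$, $\mathfrak{c}(b)=\{x\in L\mid x\ge b\}$ is the closed sublocale determined by $b$. A locale $M$ is IED (infinitely extremally disconnected) if $(\bigvee a_i)^{**}\le\bigvee a_i^{**}$ for all $\{a_i\}_{i\in I}\subseteq M$, with operations computed in $M$. $L$ is hereditarily IED if every sublocale of $L$ is IED.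
   Formalization: In (ii) and (iii) the families are taken to be nonempty: for empty I the inequality reads b ≤ 0, which fails for b = 1 in the two-element locale although that locale is hereditarily IED. *)

theory Defs
  imports Main
begin

class frame = complete_lattice +
  assumes inf_Sup_frame: "inf a (Sup B) = (SUP b\<in>B. inf a b)"

definition himp :: "'a::frame \<Rightarrow> 'a \<Rightarrow> 'a"  (infixr "\<rightarrow>\<^sub>H" 60)
  where "a \<rightarrow>\<^sub>H b = Sup {c. inf a c \<le> b}"

lemma le_himp_iff: "c \<le> (a \<rightarrow>\<^sub>H b) \<longleftrightarrow> inf a c \<le> (b::'a::frame)"
proof
  assume "c \<le> (a \<rightarrow>\<^sub>H b)"
  then have "inf a c \<le> inf a (Sup {c. inf a c \<le> b})"
    unfolding himp_def by (rule inf_mono[OF order_refl])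
  also have "\<dots> = (SUP c\<in>{c. inf a c \<le> b}. inf a c)" by (rule inf_Sup_frame)
  also have "\<dots> \<le> b" by (rule SUP_least) simp
  finally show "inf a c \<le> b" .
next
  assume "inf a c \<le> b"
  then show "c \<le> (a \<rightarrow>\<^sub>H b)" unfolding himp_def by (intro Sup_upper) simp
qed

definition is_sublocale :: "'a::frame set \<Rightarrow> bool"
  where "is_sublocale S \<longleftrightarrow> (\<forall>A\<subseteq>S. Inf A \<in> S) \<and> (\<forall>a. \<forall>s\<in>S. a \<rightarrow>\<^sub>H s \<in> S)"

definition closed_sublocale :: "'a::frame \<Rightarrow> 'a set"
  where "closed_sublocale b = {x. b \<le> x}"

(* Operations of a subset M regarded as a poset in its own right with the induced order. They are
   characterised by their order-theoretic universal properties inside M, and are meaningful only when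
   the extremum in question exists, as it does whenever M is a sublocale (see the lemmas below). *)

definition Sup_on :: "'a::order set \<Rightarrow> 'a set \<Rightarrow> 'a"
  where "Sup_on M A = (LEAST s. s \<in> M \<and> (\<forall>a\<in>A. a \<le> s))"

definition bot_on :: "'a::order set \<Rightarrow> 'a"
  where "bot_on M = (LEAST s. s \<in> M)"

definition inf_on :: "'a::order set \<Rightarrow> 'a \<Rightarrow> 'a \<Rightarrow> 'a"
  where "inf_on M a b = (GREATEST m. m \<in> M \<and> m \<le> a \<and> m \<le> b)"

definition himp_on :: "'a::order set \<Rightarrow> 'a \<Rightarrow> 'a \<Rightarrow> 'a"
  where "himp_on M a b = (GREATEST c. c \<in> M \<and> inf_on M a c \<le> b)"

definition pseudocompl_on :: "'a::order set \<Rightarrow> 'a \<Rightarrow> 'a"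
  where "pseudocompl_on M a = himp_on M a (bot_on M)"

(* A family (a i) indexed by I enters only through its set of values, so families in M are
   rendered as arbitrary subsets A of M. The empty family is allowed here, where it is harmless
   in a sublocale: both sides are the least element. By contrast, the inequality
   ((Sup A \<rightarrow>\<^sub>H b) \<rightarrow>\<^sub>H b) \<le> (SUP a\<in>A. ((a \<rightarrow>\<^sub>H b) \<rightarrow>\<^sub>H b)) of L reads b \<le> bot for A = {}, so it has to be
   restricted to nonempty A. *)

definition IED :: "'a::order set \<Rightarrow> bool"
  where "IED M \<longleftrightarrow> (\<forall>A\<subseteq>M.
    pseudocompl_on M (pseudocompl_on M (Sup_on M A))
      \<le> Sup_on M ((\<lambda>a. pseudocompl_on M (pseudocompl_on M a)) ` A))"

definition hereditarily_IED :: "'a::frame itself \<Rightarrow> bool"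
  where "hereditarily_IED L \<longleftrightarrow> (\<forall>S::'a set. is_sublocale S \<longrightarrow> IED S)"

lemma empty_family_inequality_iff:
  "((Sup {} \<rightarrow>\<^sub>H b) \<rightarrow>\<^sub>H b) \<le> (SUP a\<in>{}. ((a \<rightarrow>\<^sub>H b) \<rightarrow>\<^sub>H b)) \<longleftrightarrow> (b::'a::frame) = bot"
proof -
  have "(bot \<rightarrow>\<^sub>H b) = top" by (rule top_le) (simp add: le_himp_iff)
  moreover have "(top \<rightarrow>\<^sub>H b) = b"
  proof (rule order.antisym)
    have "inf top (top \<rightarrow>\<^sub>H b) \<le> b" by (simp only: le_himp_iff[symmetric] order_refl)
    then show "(top \<rightarrow>\<^sub>H b) \<le> b" by simp
  qed (simp add: le_himp_iff)
  ultimately show ?thesis by (simp add: bot_unique)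
qed

lemma is_sublocale_UNIV: "is_sublocale (UNIV :: 'a::frame set)"
  by (simp add: is_sublocale_def)

lemma is_sublocale_closed: "is_sublocale (closed_sublocale (b::'a::frame))"
  unfolding is_sublocale_def closed_sublocale_def
  by (simp add: le_himp_iff le_infI2 le_Inf_iff subset_iff)

lemma Sup_on_sublocale:
  assumes "is_sublocale (S::'a::frame set)"
  shows "Sup_on S A = Inf {s\<in>S. \<forall>a\<in>A. a \<le> s}"
  unfolding Sup_on_def
proof (rule Least_equality)
  have "Inf {s\<in>S. \<forall>a\<in>A. a \<le> s} \<in> S"
    using assms by (simp add: is_sublocale_def)
  then show "Inf {s\<in>S. \<forall>a\<in>A. a \<le> s} \<in> S \<and> (\<forall>a\<in>A. a \<le> Inf {s\<in>S. \<forall>a\<in>A. a \<le> s})"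
    by (auto intro: Inf_greatest)
qed (auto intro: Inf_lower)

lemma bot_on_sublocale:
  assumes "is_sublocale (S::'a::frame set)"
  shows "bot_on S = Inf S"
  unfolding bot_on_def
  using assms by (intro Least_equality) (auto simp: is_sublocale_def intro: Inf_lower)

lemma inf_on_sublocale:
  assumes "is_sublocale (S::'a::frame set)" and "a \<in> S" "b \<in> S"
  shows "inf_on S a b = inf a b"
  unfolding inf_on_def
proof (rule Greatest_equality)
  have "Inf {a, b} \<in> S"
    using assms unfolding is_sublocale_def by (metis empty_subsetI insert_subset)
  then show "inf a b \<in> S \<and> inf a b \<le> a \<and> inf a b \<le> b" by simp
qed simp

lemma himp_on_sublocale:
  assumes S: "is_sublocale (S::'a::frame set)" and ab: "a \<in> S" "b \<in> S"
  shows "himp_on S a b = (a \<rightarrow>\<^sub>H b)"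
  unfolding himp_on_def
proof (rule Greatest_equality)
  have "a \<rightarrow>\<^sub>H b \<in> S" using S ab by (simp add: is_sublocale_def)
  then show "a \<rightarrow>\<^sub>H b \<in> S \<and> inf_on S a (a \<rightarrow>\<^sub>H b) \<le> b"
    using S ab le_himp_iff[of "a \<rightarrow>\<^sub>H b" a b] by (simp add: inf_on_sublocale)
next
  fix c assume c: "c \<in> S \<and> inf_on S a c \<le> b"
  with S ab have "inf_on S a c = inf a c" by (intro inf_on_sublocale) auto
  with c show "c \<le> (a \<rightarrow>\<^sub>H b)" by (simp add: le_himp_iff)
qed

end

theory Submission
  imports Defs
begin

text \<open>
  In a sublocale \<open>S\<close> with least element \<open>b\<close>, pseudocomplementation is \<open>\<lambda>x. x \<rightarrow>\<^sub>H b\<close>, and a join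
  computed in \<open>S\<close> has the same pseudocomplement as the join computed in \<open>L\<close>, while joins in \<open>S\<close>
  dominate those in \<open>L\<close>: so the inequality in \<open>L\<close> for \<open>b\<close> yields IED for \<open>S\<close>. In \<open>closed_sublocale b\<close>,
  nonempty joins agree with those of \<open>L\<close>, so IED there is the inequality for families above \<open>b\<close>.
  Replacing each \<open>a\<close> by \<open>sup a b\<close>, which does not change \<open>a \<rightarrow>\<^sub>H b\<close>, reduces arbitrary families to
  such ones.
\<close>

lemma inf_himp_le: "inf a (a \<rightarrow>\<^sub>H b) \<le> (b::'a::frame)"
  by (simp flip: le_himp_iff)

lemma le_himp_himp: "a \<le> ((a \<rightarrow>\<^sub>H b) \<rightarrow>\<^sub>H (b::'a::frame))"
  using inf_himp_le[of a b] by (simp add: le_himp_iff inf.commute)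

lemma le_himp: "b \<le> (a \<rightarrow>\<^sub>H (b::'a::frame))"
  by (simp add: le_himp_iff)

lemma himp_antimono: "a \<le> a' \<Longrightarrow> (a' \<rightarrow>\<^sub>H b) \<le> (a \<rightarrow>\<^sub>H (b::'a::frame))"
  by (meson inf_himp_le inf_mono le_himp_iff order_refl order_trans)

lemma himp_himp_mono: "a \<le> a' \<Longrightarrow> ((a \<rightarrow>\<^sub>H b) \<rightarrow>\<^sub>H b) \<le> ((a' \<rightarrow>\<^sub>H b) \<rightarrow>\<^sub>H (b::'a::frame))"
  by (intro himp_antimono)

lemma himp_himp_self: "((b \<rightarrow>\<^sub>H b) \<rightarrow>\<^sub>H b) = (b::'a::frame)"
proof (rule order.antisym)
  have "(b \<rightarrow>\<^sub>H b) = top"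
    by (rule top_le) (simp add: le_himp_iff)
  then show "((b \<rightarrow>\<^sub>H b) \<rightarrow>\<^sub>H b) \<le> b"
    using inf_himp_le[of "b \<rightarrow>\<^sub>H b" b] by simp
qed (rule le_himp)

text \<open>Both \<open>a\<close> and \<open>b\<close> lie below
  \<open>(a \<rightarrow>\<^sub>H b) \<rightarrow>\<^sub>H b\<close>, hence so does their
  join.\<close>

lemma himp_le_sup_himp: "(a \<rightarrow>\<^sub>H b) \<le> (sup a b \<rightarrow>\<^sub>H (b::'a::frame))"
proof -
  have "sup a b \<le> ((a \<rightarrow>\<^sub>H b) \<rightarrow>\<^sub>H b)"
    by (simp add: le_himp_himp le_himp)
  \<comment> \<open>By the adjunction, \<open>x \<le> (y \<rightarrow>\<^sub>H b)\<close> and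
    \<open>y \<le> (x \<rightarrow>\<^sub>H b)\<close> both say \<open>inf x y \<le> b\<close>, so
    the two elements may be exchanged.\<close>
  then show ?thesis
    by (simp add: le_himp_iff inf.commute)
qed

lemma bot_on_in_sublocale: "is_sublocale (S::'a::frame set) \<Longrightarrow> bot_on S \<in> S"
  by (simp add: bot_on_sublocale is_sublocale_def)

lemma Sup_on_in_sublocale: "is_sublocale (S::'a::frame set) \<Longrightarrow> Sup_on S A \<in> S"
  by (simp add: Sup_on_sublocale is_sublocale_def)

lemma Sup_le_Sup_on: "is_sublocale (S::'a::frame set) \<Longrightarrow> Sup A \<le> Sup_on S A"
  by (auto simp: Sup_on_sublocale intro!: Inf_greatest Sup_least)

lemma Sup_on_le: "is_sublocale (S::'a::frame set) \<Longrightarrow> s \<in> S \<Longrightarrow> Sup A \<le> s \<Longrightarrow> Sup_on S A \<le> s"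
  by (auto simp: Sup_on_sublocale Sup_le_iff intro!: Inf_lower)

lemma pseudocompl_on_pseudocompl_on:
  assumes "is_sublocale (S::'a::frame set)" and "a \<in> S"
  shows "pseudocompl_on S (pseudocompl_on S a) = ((a \<rightarrow>\<^sub>H bot_on S) \<rightarrow>\<^sub>H bot_on S)"
proof -
  have "(a \<rightarrow>\<^sub>H bot_on S) \<in> S"
    using assms bot_on_in_sublocale[OF assms(1)] by (simp add: is_sublocale_def)
  then show ?thesis
    using assms by (simp add: pseudocompl_on_def himp_on_sublocale bot_on_in_sublocale)
qed

text \<open>Sublocales inherit the Heyting operation of the whole locale, so joins are the only
  operations that still have to be computed in \<open>S\<close>.\<close>

lemma IED_sublocale_iff:
  assumes S: "is_sublocale (S::'a::frame set)"
  shows "IED S \<longleftrightarrow> (\<forall>A\<subseteq>S. ((Sup_on S A \<rightarrow>\<^sub>H bot_on S) \<rightarrow>\<^sub>H bot_on S)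
           \<le> Sup_on S ((\<lambda>a. (a \<rightarrow>\<^sub>H bot_on S) \<rightarrow>\<^sub>H bot_on S) ` A))"
proof -
  have "(\<lambda>a. pseudocompl_on S (pseudocompl_on S a)) ` A
      = (\<lambda>a. (a \<rightarrow>\<^sub>H bot_on S) \<rightarrow>\<^sub>H bot_on S) ` A" if "A \<subseteq> S" for A
    using that S by (intro image_cong) (auto simp: pseudocompl_on_pseudocompl_on)
  then show ?thesis
    using S by (simp add: IED_def pseudocompl_on_pseudocompl_on Sup_on_in_sublocale)
qed

text \<open>The join in \<open>S\<close> may be larger than \<open>Sup A\<close>, but it is the
  least bound of \<open>A\<close> in \<open>S\<close>, and the right-hand side is such a bound
  because \<open>b \<in> S\<close>.\<close>

lemma Sup_on_himp_himp_le:
  assumes S: "is_sublocale (S::'a::frame set)" and b: "b \<in> S"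
  shows "((Sup_on S A \<rightarrow>\<^sub>H b) \<rightarrow>\<^sub>H b) \<le> ((Sup A \<rightarrow>\<^sub>H b) \<rightarrow>\<^sub>H b)"
proof -
  have "((Sup A \<rightarrow>\<^sub>H b) \<rightarrow>\<^sub>H b) \<in> S"
    using S b by (simp add: is_sublocale_def)
  then have "Sup_on S A \<le> ((Sup A \<rightarrow>\<^sub>H b) \<rightarrow>\<^sub>H b)"
    using S by (intro Sup_on_le le_himp_himp)
  then have "(Sup A \<rightarrow>\<^sub>H b) \<le> (Sup_on S A \<rightarrow>\<^sub>H b)"
    by (simp add: le_himp_iff inf.commute)
  then show ?thesis
    by (rule himp_antimono)
qed

lemma IED_sublocaleI:
  assumes S: "is_sublocale (S::'a::frame set)"
    and ineq: "\<And>(b::'a) A. A \<noteq> {} \<Longrightarrow> ((Sup A \<rightarrow>\<^sub>H b) \<rightarrow>\<^sub>H b) \<le> (SUP a\<in>A. ((a \<rightarrow>\<^sub>H b) \<rightarrow>\<^sub>H b))"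
  shows "IED S"
  unfolding IED_sublocale_iff[OF S]
proof (intro allI impI)
  fix A assume "A \<subseteq> S"
  let ?b = "bot_on S"
  let ?dd = "\<lambda>a. (a \<rightarrow>\<^sub>H ?b) \<rightarrow>\<^sub>H ?b"
  show "?dd (Sup_on S A) \<le> Sup_on S (?dd ` A)"
  proof (cases "A = {}")
    case True
    \<comment> \<open>\<open>ineq\<close> does not cover the empty family; its join in
      \<open>S\<close> is the least element, which double negation relative to itself fixes.\<close>
    have "Sup_on S {} = ?b"
      using S by (simp add: Sup_on_sublocale bot_on_sublocale)
    with True show ?thesis
      by (simp add: himp_himp_self)
  next
    case False
    have "?dd (Sup_on S A) \<le> ?dd (Sup A)"
      using S bot_on_in_sublocale[OF S] by (rule Sup_on_himp_himp_le)
    also have "\<dots> \<le> Sup (?dd ` A)"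
      using False by (rule ineq)
    also have "\<dots> \<le> Sup_on S (?dd ` A)"
      using S by (rule Sup_le_Sup_on)
    finally show ?thesis .
  qed
qed

lemma bot_on_closed_sublocale: "bot_on (closed_sublocale b) = (b::'a::frame)"
  unfolding bot_on_def closed_sublocale_def by (rule Least_equality) auto

text \<open>An up-set contains the join of any nonempty subset. The empty join would be
  \<open>b\<close> here but \<open>bot\<close> in the whole locale.\<close>

lemma Sup_on_closed_sublocale:
  assumes "A \<noteq> {}" and "A \<subseteq> closed_sublocale (b::'a::frame)"
  shows "Sup_on (closed_sublocale b) A = Sup A"
proof (rule order.antisym)
  have "Sup A \<in> closed_sublocale b"
    using assms by (force simp: closed_sublocale_def intro: Sup_upper2)
  then show "Sup_on (closed_sublocale b) A \<le> Sup A"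
    by (simp add: Sup_on_le is_sublocale_closed)
qed (rule Sup_le_Sup_on[OF is_sublocale_closed])

lemma IED_closed_sublocaleD:
  assumes "IED (closed_sublocale (b::'a::frame))" and "A \<noteq> {}" and "A \<subseteq> closed_sublocale b"
  shows "((Sup A \<rightarrow>\<^sub>H b) \<rightarrow>\<^sub>H b) \<le> (SUP a\<in>A. ((a \<rightarrow>\<^sub>H b) \<rightarrow>\<^sub>H b))"
proof -
  \<comment> \<open>The right-hand join in IED is also taken over elements above \<open>b\<close>,
    so it too agrees with the join in the whole locale.\<close>
  have "(\<lambda>a. (a \<rightarrow>\<^sub>H b) \<rightarrow>\<^sub>H b) ` A \<subseteq> closed_sublocale b"
    by (auto simp: closed_sublocale_def le_himp)
  then have "Sup_on (closed_sublocale b) ((\<lambda>a. (a \<rightarrow>\<^sub>H b) \<rightarrow>\<^sub>H b) ` A) = (SUP a\<in>A. ((a \<rightarrow>\<^sub>H b) \<rightarrow>\<^sub>H b))"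
    using assms(2) by (intro Sup_on_closed_sublocale) auto
  with assms show ?thesis
    by (metis IED_sublocale_iff is_sublocale_closed bot_on_closed_sublocale Sup_on_closed_sublocale)
qed

lemma Sup_himp_himp_le_from_closed:
  assumes ineq: "\<And>A. A \<noteq> {} \<Longrightarrow> A \<subseteq> closed_sublocale b \<Longrightarrow>
      ((Sup A \<rightarrow>\<^sub>H b) \<rightarrow>\<^sub>H b) \<le> (SUP a\<in>A. ((a \<rightarrow>\<^sub>H b) \<rightarrow>\<^sub>H b))"
    and "A \<noteq> {}"
  shows "((Sup A \<rightarrow>\<^sub>H b) \<rightarrow>\<^sub>H b) \<le> (SUP a\<in>A. ((a \<rightarrow>\<^sub>H b) \<rightarrow>\<^sub>H (b::'a::frame)))"
proof -
  let ?A = "(\<lambda>a. sup a b) ` A"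
  have "Sup A \<le> Sup ?A"
    by (intro Sup_least) (auto intro: SUP_upper2)
  then have "((Sup A \<rightarrow>\<^sub>H b) \<rightarrow>\<^sub>H b) \<le> ((Sup ?A \<rightarrow>\<^sub>H b) \<rightarrow>\<^sub>H b)"
    by (rule himp_himp_mono)
  also have "\<dots> \<le> (SUP a\<in>?A. ((a \<rightarrow>\<^sub>H b) \<rightarrow>\<^sub>H b))"
    using \<open>A \<noteq> {}\<close> by (intro ineq) (auto simp: closed_sublocale_def)
  also have "\<dots> = (SUP a\<in>A. ((sup a b \<rightarrow>\<^sub>H b) \<rightarrow>\<^sub>H b))"
    by (simp add: image_image)
  \<comment> \<open>Termwise: \<open>himp_le_sup_himp\<close> is reversed by the antitone map
    \<open>\<lambda>x. x \<rightarrow>\<^sub>H b\<close>.\<close>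
  also have "\<dots> \<le> (SUP a\<in>A. ((a \<rightarrow>\<^sub>H b) \<rightarrow>\<^sub>H b))"
    by (intro SUP_mono' himp_antimono himp_le_sup_himp)
  finally show ?thesis .
qed

theorem proposition6p6:
  shows "(hereditarily_IED TYPE('a::frame) \<longleftrightarrow>
           (\<forall>(b::'a) A. A \<noteq> {} \<longrightarrow>
             ((Sup A \<rightarrow>\<^sub>H b) \<rightarrow>\<^sub>H b) \<le> (SUP a\<in>A. ((a \<rightarrow>\<^sub>H b) \<rightarrow>\<^sub>H b))))
       \<and> (hereditarily_IED TYPE('a) \<longleftrightarrow>
           (\<forall>(b::'a) A. A \<noteq> {} \<longrightarrow> A \<subseteq> closed_sublocale b \<longrightarrow>
             ((Sup A \<rightarrow>\<^sub>H b) \<rightarrow>\<^sub>H b) \<le> (SUP a\<in>A. ((a \<rightarrow>\<^sub>H b) \<rightarrow>\<^sub>H b))))"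
    (is "(?i \<longleftrightarrow> ?ii) \<and> (_ \<longleftrightarrow> ?iii)")
proof -
  \<comment> \<open>The implications form a cycle through \<open>?i\<close>, \<open>?iii\<close>,
    \<open>?ii\<close> and back to \<open>?i\<close>.\<close>
  have "?iii" if "?i"
    using that by (auto simp: hereditarily_IED_def intro: IED_closed_sublocaleD is_sublocale_closed)
  moreover have "?ii" if "?iii"
    using that by (blast intro: Sup_himp_himp_le_from_closed)
  moreover have "?i" if "?ii"
    using that by (auto simp: hereditarily_IED_def intro: IED_sublocaleI)
  ultimately show ?thesis
    by blast
qed

end
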